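(* Define the coefficients $k(n),l(n),t(n)$ and, for each choice of sign $\varepsilon\in\{1,-1\}$, the coefficients $o(n),p(n),z(n)$ (depending on $\varepsilon$) by the power series expansions $$\sum_{n=0}^{\infty}k(n)q^n=\left(q,q^6;q^7\right)_\infty\left(-q^9,-q^{12};q^{21}\right)_\infty,$$ $$\sum_{n=0}^{\infty}l(n)q^n=\left(q^2,q^5;q^7\right)_\infty\left(-q^3,-q^{18};q^{21}\right)_\infty,$$ $$\sum_{n=0}^{\infty}t(n)q^n=\left(q^3,q^4;q^7\right)_\infty\left(-q^6,-q^{15};q^{21}\right)_\infty,$$ $$\sum_{n=0}^{\infty}o(n)q^n=\left(\varepsilon q,\varepsilon q^6;q^7\right)_\infty^2\left(q^6,q^{15};q^{21}\right)_\infty,$$ $$\sum_{n=0}^{\infty}p(n)q^n=\left(\varepsilon q^2,\varepsilon q^5;q^7\right)_\infty^2\left(q^9,q^{12};q^{21}\right)_\infty,$$ $$\sum_{n=0}^{\infty}z(n)q^n=\left(\varepsilon q^3,\varepsilon q^4;q^7\right)_\infty^2\left(q^3,q^{18};q^{21}\right)_\infty.$$ Then, for each choice of $\varepsilon\in\{1,-1\}$ and all integers $n\ge 0$, $$k(7n+4)=l(7n+6)=t(7n+5)=o(7n+4)=p(7n+1)=z(7n+5)=0.$$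
   Context: For complex numbers $a,q$ with $|q|<1$, $(a;q)_\infty:=\prod_{k=0}^{\infty}(1-aq^k)$ and $(a_1,a_2,\dots,a_m;q)_\infty:=(a_1;q)_\infty(a_2;q)_\infty\cdots(a_m;q)_\infty$. The exponent $2$ on a product $(a_1,a_2;q)_\infty^2$ means the square of the whole product $(a_1,a_2;q)_\infty$. The infinite products are expanded as power series in $q$. *)

theory Defs
  imports "HOL-Complex_Analysis.Complex_Analysis"
begin

text \<open>
  For \<open>norm q < 1\<close> the product converges absolutely. A product with finitely many vanishing
  factors is allowed (\<open>prodinf\<close> is then 0), which happens for example at \<open>a = 1\<close>.
\<close>
definition qpochhammer :: "complex \<Rightarrow> complex \<Rightarrow> complex" where
  "qpochhammer a q = (\<Prod>k. 1 - a * q ^ k)"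

definition qpochhammers :: "complex list \<Rightarrow> complex \<Rightarrow> complex" where
  "qpochhammers as q = (\<Prod>a\<leftarrow>as. qpochhammer a q)"

lemma qpochhammer_holomorphic:
  assumes "m \<ge> 1"
  shows "(\<lambda>q. qpochhammer (c * q ^ j) (q ^ m)) holomorphic_on ball 0 1"
proof (rule holomorphic_uniform_sequence)
  let ?f = "\<lambda>k q. 1 - c * q ^ j * (q ^ m) ^ k :: complex"
  show "(\<lambda>q. \<Prod>k<N. ?f k q) holomorphic_on ball 0 1" for N
    by (intro holomorphic_intros)
  fix x :: complex assume x: "x \<in> ball 0 1"
  then obtain d where d: "d > 0" "cball x d \<subseteq> ball 0 1"
    using open_contains_cball open_ball by blast
  have bound: "norm (?f k q - 1) \<le> norm c * norm q ^ k" if "q \<in> ball 0 1" for k q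
  proof -
    have "norm q ^ (j + m * k) \<le> norm q ^ k"
      using that assms by (intro power_decreasing) (auto intro: trans_le_add2)
    moreover have "norm (?f k q - 1) = norm c * norm q ^ (j + m * k)"
      unfolding power_add power_mult by (simp add: norm_mult norm_power)
    ultimately show ?thesis
      by (simp only: mult_left_mono norm_ge_zero)
  qed
  have conv: "convergent_prod (\<lambda>k. ?f k q)" if "q \<in> ball 0 1" for q
  proof -
    have "summable (\<lambda>k. norm (?f k q - 1))"
    proof (rule summable_comparison_test')
      show "summable (\<lambda>k. norm c * norm q ^ k)"
        using that by (auto intro!: summable_mult summable_geometric)
      show "norm (norm (?f k q - 1)) \<le> norm c * norm q ^ k" if "k \<ge> 0" for k
        using bound[OF \<open>q \<in> ball 0 1\<close>, of k] by simp
    qed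
    then show ?thesis
      by (intro abs_convergent_prod_imp_convergent_prod summable_imp_abs_convergent_prod)
  qed
  have "uniformly_convergent_on (cball x d) (\<lambda>N q. \<Prod>k<N. ?f k q)"
  proof (rule uniformly_convergent_on_prod')
    obtain R where R: "0 \<le> R" "R < 1" "\<And>q. q \<in> cball x d \<Longrightarrow> norm q \<le> R"
    proof -
      obtain y where "y \<in> cball x d" "\<And>q. q \<in> cball x d \<Longrightarrow> norm q \<le> norm y"
        using continuous_attains_sup[of "cball x d" norm] d continuous_on_norm_id
        by (metis cball_eq_empty compact_cball less_le_not_le not_less)
      then show ?thesis using that[of "norm y"] d by auto
    qed
    show "uniformly_convergent_on (cball x d) (\<lambda>N q. \<Sum>k<N. norm (?f k q - 1))"
    proof (rule Weierstrass_m_test'[of _ _ "\<lambda>k. norm c * R ^ k"])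
      fix k q assume q: "q \<in> cball x d"
      then have "q \<in> ball 0 1" using d by blast
      then have "norm (?f k q - 1) \<le> norm c * norm q ^ k" by (rule bound)
      also have "\<dots> \<le> norm c * R ^ k"
        using R(3)[OF q] by (intro mult_left_mono power_mono) auto
      finally show "norm (norm (?f k q - 1)) \<le> norm c * R ^ k" by simp
    qed (use R in \<open>auto intro!: summable_mult summable_geometric\<close>)
  qed (auto intro!: continuous_intros)
  then obtain g where g: "uniform_limit (cball x d) (\<lambda>N q. \<Prod>k<N. ?f k q) g sequentially"
    by (auto simp: uniformly_convergent_on_def)
  have "g q = qpochhammer (c * q ^ j) (q ^ m)" if q: "q \<in> cball x d" for q
  proof -
    have "(\<lambda>N. \<Prod>k<N. ?f k q) \<longlonglongrightarrow> qpochhammer (c * q ^ j) (q ^ m)"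
      unfolding qpochhammer_def LIMSEQ_lessThan_iff_atMost
      using conv[of q] q d by (intro convergent_prod_LIMSEQ) blast
    with tendsto_uniform_limitI[OF g q] show ?thesis
      by (rule LIMSEQ_unique)
  qed
  then have "uniform_limit (cball x d) (\<lambda>N q. \<Prod>k<N. ?f k q)
      (\<lambda>q. qpochhammer (c * q ^ j) (q ^ m)) sequentially"
    using g by (simp add: uniform_limit_iff)
  with d show "\<exists>d>0. cball x d \<subseteq> ball 0 1 \<and> uniform_limit (cball x d)
      (\<lambda>N q. \<Prod>k<N. ?f k q) (\<lambda>q. qpochhammer (c * q ^ j) (q ^ m)) sequentially"
    by blast
qed simp

text \<open>
  Coefficient sequences are specified by requiring that their power series sum to the given product
  on the whole unit disc; this lemma shows that such a sequence exists for every product of the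
  shape considered. It is unique by the identity theorem for power series.
\<close>
lemma ex_power_series_coeffs: "\<exists>k. \<forall>q::complex. norm q < 1 \<longrightarrow> (\<lambda>n. k n * q ^ n) sums
    ((qpochhammers [c1*q^a1, c1*q^a2] (q^7))^e * qpochhammers [c2*(q^b1), c2*(q^b2)] (q^21))"
proof -
  let ?F = "\<lambda>q. (qpochhammers [c1*q^a1, c1*q^a2] (q^7))^e * qpochhammers [c2*(q^b1), c2*(q^b2)] (q^21)"
  have h: "?F holomorphic_on ball 0 1"
    unfolding qpochhammers_def by (auto intro!: holomorphic_intros qpochhammer_holomorphic)
  show ?thesis
    using holomorphic_power_series[OF h] 
    by (intro exI[of _ "\<lambda>n. (deriv ^^ n) ?F 0 / fact n"]) auto
qed

end

theory Submission
  imports Defs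
begin

text \<open>
  By the Jacobi triple product, each of the six products becomes, after multiplication by suitable
  powers of the infinite products \<open>(q\<^sup>7; q\<^sup>7)\<close> and \<open>(q\<^sup>2\<^sup>1; q\<^sup>2\<^sup>1)\<close>, a signed sum of powers of \<open>q\<close> over
  a lattice, with a quadratic polynomial as exponent. The multiplier is a nonvanishing function of \<open>q\<^sup>7\<close>, so it
  commutes with the passage to a residue class of exponents modulo 7, which a filter by seventh roots of
  unity performs (\<open>residue_class_coefficients_vanish\<close>). Hence it suffices that the part of the signed sum
  with exponents in the stated residue class vanishes.

  There the terms, which are indexed by a coset of a sublattice, cancel in pairs. For \<open>k\<close>, \<open>l\<close> and \<open>t\<close> the
  exponent is, up to scaling and completing squares, the form \<open>x\<^sup>2 + 3 * y\<^sup>2\<close>. It has rational reflections with denominator 7, since 7 is a norm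
  (\<open>7 = 2\<^sup>2 + 3 * 1\<^sup>2\<close>), and one of them is integral exactly on the coset in question and changes the
  parity that determines the sign (\<open>two_theta_coefficients_vanish\<close>). For the other three series the form in
  \<open>x = m + n\<close> and the third index is, similarly scaled, \<open>x\<^sup>2 + 6 * y\<^sup>2\<close>, with \<open>7 = 1\<^sup>2 + 6 * 1\<^sup>2\<close>; the
  reflection fixes \<open>m - n\<close> (\<open>three_theta_coefficients_vanish\<close>).

  The triple product itself is obtained as the limit of its finite form, which is a shifted instance of
  the \<open>q\<close>-binomial theorem.
\<close>

section \<open>Gaussian binomials and the finite triple product\<close>

definition qfact :: "complex \<Rightarrow> nat \<Rightarrow> complex" where
  "qfact q n = (\<Prod>k<n. 1 - q * q ^ k)"

definition qbinom :: "complex \<Rightarrow> nat \<Rightarrow> nat \<Rightarrow> complex" where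
  "qbinom q n j = (if j \<le> n then qfact q n / (qfact q j * qfact q (n - j)) else 0)"

definition tri :: "int \<Rightarrow> int" where
  "tri m = m * (m - 1) div 2"

lemma two_tri: "2 * tri m = m * (m - 1)"
  unfolding tri_def by (cases "even m") auto

lemma tri_of_nat: "tri (int j) = int (j choose 2)"
  by (cases j) (auto simp: tri_def choose_two zdiv_int algebra_simps)

lemma one_minus_power_nonzero:
  assumes "norm (q::complex) < 1" shows "1 - q * q ^ k \<noteq> 0"
proof
  assume "1 - q * q ^ k = 0"
  then have "norm (q ^ Suc k) = 1" by simp
  moreover have "norm (q ^ Suc k) < 1"
    using power_Suc_less_one[of "norm q" k] assms by (cases "q = 0") (auto simp: norm_power norm_mult)
  ultimately show False by simp
qed

lemma qfact_nonzero: "norm q < 1 \<Longrightarrow> qfact q n \<noteq> 0"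
  unfolding qfact_def using one_minus_power_nonzero by simp

text \<open>
  The \<open>q\<close>-Pascal rule, which amounts to
  \<open>1 - q ^ (n + 1) = (1 - q ^ (n - j)) + q ^ (n - j) * (1 - q ^ (j + 1))\<close>.
\<close>
lemma qbinom_Suc_Suc:
  assumes "norm q < 1" "j \<le> n"
  shows "qbinom q (Suc n) (Suc j) = qbinom q n (Suc j) + q ^ (n - j) * qbinom q n j"
proof (cases "j = n")
  case True
  then show ?thesis
    using qfact_nonzero[OF assms(1)] by (simp add: qbinom_def)
next
  case False
  with assms obtain d where n: "n = Suc (j + d)"
    by (metis add_Suc_right le_neq_implies_less less_iff_Suc_add)
  have q: "qfact q (Suc i) = qfact q i * (1 - q * q ^ i)" for i by (simp add: qfact_def)
  note nz = qfact_nonzero[OF assms(1)] one_minus_power_nonzero[OF assms(1)]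
  show ?thesis
    unfolding n qbinom_def using nz
    by (simp add: q divide_simps del: power_Suc) (simp add: power_add algebra_simps)
qed

text \<open>
  Gauss's \<open>q\<close>-binomial theorem. Multiplying by the next factor \<open>1 + x * q ^ n\<close> acts on the
  coefficients exactly as the \<open>q\<close>-Pascal rule.
\<close>
lemma q_binomial_theorem:
  assumes "norm q < 1"
  shows "(\<Prod>k<n. 1 + x * q ^ k) = (\<Sum>j\<le>n. qbinom q n j * q ^ (j choose 2) * x ^ j)"
proof (induction n)
  case 0
  show ?case by (simp add: qbinom_def qfact_def binomial_eq_0)
next
  case (Suc n)
  define T where "T = (\<lambda>n j. qbinom q n j * q ^ (j choose 2) * x ^ j)"
  have T0: "T n 0 = 1" for n
    using qfact_nonzero[OF assms] by (simp add: T_def qbinom_def qfact_def binomial_eq_0)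
  have step: "T (Suc n) (Suc j) = T n (Suc j) + x * q ^ n * T n j" if "j \<le> n" for j
  proof -
    have e: "q ^ n = q ^ (n - j) * q ^ j" using that by (simp flip: power_add)
    have c: "Suc j choose 2 = j + (j choose 2)"
      by (simp add: numeral_2_eq_2)
    show ?thesis
      unfolding T_def qbinom_Suc_Suc[OF assms that] e c by (simp add: power_add algebra_simps)
  qed
  have "(\<Sum>j\<le>Suc n. T (Suc n) j) = T n 0 + (\<Sum>j\<le>n. T n (Suc j)) + x * q ^ n * (\<Sum>j\<le>n. T n j)"
    unfolding sum.atMost_Suc_shift T0 by (simp add: step sum.distrib sum_distrib_left)
  also have "T n 0 + (\<Sum>j\<le>n. T n (Suc j)) = (\<Sum>j\<le>Suc n. T n j)"
    by (simp only: sum.atMost_Suc_shift)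
  also have "\<dots> = (\<Sum>j\<le>n. T n j)" by (simp add: T_def qbinom_def)
  finally show ?case using Suc by (simp add: T_def algebra_simps)
qed

text \<open>
  The \<open>q\<close>-binomial theorem with \<open>2 * N\<close> factors, started at \<open>x = - z / q ^ N\<close> so that the factors
  are centred: the upper half is \<open>\<Prod>k<N. 1 - z * q ^ k\<close>, and each factor \<open>1 - z / q ^ (k + 1)\<close> of the
  lower half is \<open>1 - q / z * q ^ k\<close> up to a monomial. The product of these monomials is \<open>c\<close>, which
  cancels against the shift \<open>j = m + N\<close> of the summation index.
\<close>
lemma finite_triple_product:
  assumes q: "norm q < 1" "q \<noteq> 0" and z: "z \<noteq> 0"
  shows "(\<Prod>k<N. 1 - z * q ^ k) * (\<Prod>k<N. 1 - q / z * q ^ k) =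
    (\<Sum>m\<in>{- int N..int N}. qbinom q (2 * N) (nat (m + int N)) * ((- z) powi m * q powi tri m))"
proof -
  define c where "c = (- z) ^ N / q powi tri (int N + 1)"
  have "c \<noteq> 0" using q z by (simp add: c_def)
  have pc: "(\<Prod>k<N. - z / q ^ Suc k) = c"
  proof -
    have "(\<Prod>k<N. - z / q ^ Suc k) = (- z) ^ N / q powi tri (int N + 1)" for N
    proof (induction N)
      case 0 show ?case by (simp add: tri_def)
    next
      case (Suc N)
      have "tri (int (Suc N) + 1) = tri (int N + 1) + int (Suc N)"
        using two_tri[of "int N + 1"] two_tri[of "int (Suc N) + 1"] by (simp add: algebra_simps)
      then have e: "q powi tri (int (Suc N) + 1) = q powi tri (int N + 1) * q ^ Suc N"
        using q by (simp add: power_int_add power_int_of_nat del: of_nat_Suc)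
      show ?case unfolding prod.lessThan_Suc Suc e by simp
    qed
    then show ?thesis by (simp add: c_def)
  qed
  have split: "(\<Prod>k<n + l. f k) = (\<Prod>k<n. f k) * (\<Prod>k<l. f (n + k))" for n l and f :: "nat \<Rightarrow> complex"
    by (induction l) (simp_all add: mult.assoc)
  \<comment> \<open>The lower half, read in reverse order.\<close>
  have "(\<Prod>k<N. 1 - z / q ^ N * q ^ k) = (\<Prod>k<N. 1 - z / q ^ N * q ^ (N - Suc k))"
    by (subst prod.nat_diff_reindex[symmetric]) simp
  also have "\<dots> = (\<Prod>k<N. (- z / q ^ Suc k) * (1 - q / z * q ^ k))"
  proof (rule prod.cong)
    fix k assume "k \<in> {..<N}"
    then have "q ^ N = q ^ (N - Suc k) * q ^ Suc k" by (simp flip: power_add power_Suc)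
    then show "1 - z / q ^ N * q ^ (N - Suc k) = (- z / q ^ Suc k) * (1 - q / z * q ^ k)"
      using q z by (simp add: field_simps)
  qed simp
  also have "\<dots> = c * (\<Prod>k<N. 1 - q / z * q ^ k)"
    by (simp only: prod.distrib pc)
  finally have left: "(\<Prod>k<N. 1 - z / q ^ N * q ^ k) = c * (\<Prod>k<N. 1 - q / z * q ^ k)" .
  have "c * ((\<Prod>k<N. 1 - z * q ^ k) * (\<Prod>k<N. 1 - q / z * q ^ k)) = (\<Prod>k<N + N. 1 + (- z / q ^ N) * q ^ k)"
    unfolding split using left q by (simp add: power_add)
  also have "\<dots> = (\<Sum>j\<le>2 * N. qbinom q (2 * N) j * q ^ (j choose 2) * (- z / q ^ N) ^ j)"
    unfolding q_binomial_theorem[OF q(1)] by (simp add: mult_2)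
  also have "\<dots> = (\<Sum>m\<in>{- int N..int N}.
      c * (qbinom q (2 * N) (nat (m + int N)) * ((- z) powi m * q powi tri m)))"
  proof (rule sum.reindex_bij_witness[of _ "\<lambda>m. nat (m + int N)" "\<lambda>j. int j - int N"])
    fix j assume "j \<in> {..2 * N}"
    have "tri (int j) = tri (int j - int N) - tri (int N + 1) + int N * int j"
      using two_tri[of "int j"] two_tri[of "int j - int N"] two_tri[of "int N + 1"]
      by (simp add: algebra_simps)
    then have "q ^ (j choose 2) = q powi tri (int j - int N) / q powi tri (int N + 1) * (q ^ N) ^ j"
      using q by (simp add: power_int_add power_int_diff power_mult power_int_mult
        flip: tri_of_nat power_int_of_nat)
    moreover have "(- z) ^ j = (- z) powi (int j - int N) * (- z) ^ N"
      using z by (simp add: power_int_diff)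
    ultimately show "c * (qbinom q (2 * N) (nat (int j - int N + int N)) * ((- z) powi (int j - int N) * q powi tri (int j - int N))) =
         qbinom q (2 * N) j * q ^ (j choose 2) * (- z / q ^ N) ^ j"
      using q unfolding power_divide by (simp add: c_def)
  qed auto
  finally show ?thesis
    unfolding sum_distrib_left[symmetric] using \<open>c \<noteq> 0\<close> by simp
qed

section \<open>The Jacobi triple product\<close>

lemma qpochhammer_convergent_prod:
  fixes a q :: complex
  assumes "norm q < 1"
  shows "convergent_prod (\<lambda>k. 1 - a * q ^ k)"
proof -
  have "summable (\<lambda>k. norm a * norm q ^ k)"
    using assms by (intro summable_mult summable_geometric) auto
  then have "summable (\<lambda>k. norm (1 - a * q ^ k - 1))"
    by (simp add: norm_mult norm_power)
  then show ?thesis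
    by (intro abs_convergent_prod_imp_convergent_prod summable_imp_abs_convergent_prod)
qed

lemma qpochhammer_LIMSEQ:
  assumes "norm q < 1"
  shows "(\<lambda>n. \<Prod>k<n. 1 - a * q ^ k) \<longlonglongrightarrow> qpochhammer a q"
  unfolding qpochhammer_def LIMSEQ_lessThan_iff_atMost
  by (rule convergent_prod_LIMSEQ[OF qpochhammer_convergent_prod[OF assms]])

lemma qpochhammer_self_nonzero:
  assumes "norm q < 1" shows "qpochhammer q q \<noteq> 0"
  unfolding qpochhammer_def
  by (rule prodinf_nonzero[OF qpochhammer_convergent_prod[OF assms]])
     (use one_minus_power_nonzero[OF assms] in auto)

text \<open>
  A bound uniform in \<open>n\<close> and \<open>j\<close>, for dominated convergence: the sequence of \<open>q\<close>-factorials converges to a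
  nonzero limit, so both it and its inverse are bounded.
\<close>
lemma qbinom_bounded:
  assumes "norm q < 1"
  obtains K where "\<And>n j. norm (qbinom q n j) \<le> K"
proof -
  have lim: "qfact q \<longlonglongrightarrow> qpochhammer q q"
    using qpochhammer_LIMSEQ[OF assms, of q] by (simp add: qfact_def[abs_def])
  have "Bseq (qfact q)" by (rule convergent_imp_Bseq) (use lim convergentI in blast)
  then obtain A where A: "A > 0" "\<And>n. norm (qfact q n) \<le> A" by (auto simp: Bseq_def)
  have "(\<lambda>n. inverse (qfact q n)) \<longlonglongrightarrow> inverse (qpochhammer q q)"
    by (rule tendsto_inverse[OF lim qpochhammer_self_nonzero[OF assms]])
  then have "Bseq (\<lambda>n. inverse (qfact q n))"
    by (intro convergent_imp_Bseq) (use convergentI in blast)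
  then obtain B where B: "B > 0" "\<And>n. norm (inverse (qfact q n)) \<le> B" by (auto simp: Bseq_def)
  have "norm (qbinom q n j) \<le> A * (B * B)" for n j
  proof (cases "j \<le> n")
    case True
    then have "norm (qbinom q n j) =
        norm (qfact q n) * (norm (inverse (qfact q j)) * norm (inverse (qfact q (n - j))))"
      by (simp add: qbinom_def divide_inverse norm_mult)
    also have "\<dots> \<le> A * (B * B)"
      using A B by (intro mult_mono) auto
    finally show ?thesis .
  qed (use A B in \<open>simp add: qbinom_def\<close>)
  then show ?thesis by (rule that)
qed

lemma qbinom_LIMSEQ:
  assumes "norm q < 1"
  shows "(\<lambda>N. qbinom q (2 * N) (nat (m + int N))) \<longlonglongrightarrow> 1 / qpochhammer q q"
proof -
  have lim: "qfact q \<longlonglongrightarrow> qpochhammer q q"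
    using qpochhammer_LIMSEQ[OF assms, of q] by (simp add: qfact_def[abs_def])
  note nz = qpochhammer_self_nonzero[OF assms]
  have top: "filterlim (\<lambda>N. nat (i + int N)) at_top sequentially" for i
    unfolding filterlim_at_top
  proof
    fix Z
    show "\<forall>\<^sub>F N in sequentially. Z \<le> nat (i + int N)"
      using eventually_ge_at_top[of "Z + nat \<bar>i\<bar>"] by eventually_elim linarith
  qed
  have "(\<lambda>N. qfact q (2 * N) / (qfact q (nat (m + int N)) * qfact q (nat (- m + int N))))
      \<longlonglongrightarrow> qpochhammer q q / (qpochhammer q q * qpochhammer q q)"
    by (intro tendsto_intros filterlim_compose[OF lim] top filterlim_subseq) (use nz in \<open>auto simp: strict_mono_def\<close>)
  moreover have "\<forall>\<^sub>F N in sequentially.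
      qfact q (2 * N) / (qfact q (nat (m + int N)) * qfact q (nat (- m + int N))) =
      qbinom q (2 * N) (nat (m + int N))"
    using eventually_ge_at_top[of "nat \<bar>m\<bar>"]
  proof eventually_elim
    case (elim N)
    then have "nat (m + int N) \<le> 2 * N" "2 * N - nat (m + int N) = nat (- m + int N)" by linarith+
    then show ?case by (simp add: qbinom_def)
  qed
  ultimately show ?thesis
    using nz by (auto dest: tendsto_cong[THEN iffD1, rotated])
qed

text \<open>Tannery's theorem, transported from \<open>nat\<close> to \<open>int\<close> by a bijection.\<close>
lemma dominated_convergence_has_sum_int:
  fixes a :: "nat \<Rightarrow> int \<Rightarrow> complex"
  assumes sums: "\<And>N. (a N has_sum S N) UNIV"
    and lim: "\<And>m. (\<lambda>N. a N m) \<longlonglongrightarrow> b m" "S \<longlonglongrightarrow> L"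
    and dom: "\<And>N m. norm (a N m) \<le> M m" "M summable_on UNIV"
  shows "(b has_sum L) UNIV"
proof -
  have bij: "bij_betw int_decode UNIV UNIV" by (rule bij_int_decode)
  have M: "summable (\<lambda>i. M (int_decode i))"
    using dom(2) unfolding summable_on_reindex_bij_betw[OF bij, symmetric]
    by (rule summable_on_imp_summable)
  have "suminf (\<lambda>i. a N (int_decode i)) = S N" for N
    using sums[of N] unfolding has_sum_reindex_bij_betw[OF bij, symmetric]
    by (metis has_sum_imp_sums sums_unique)
  moreover have "summable (\<lambda>i. norm (b (int_decode i))) \<and>
      (\<lambda>N. suminf (\<lambda>i. a N (int_decode i))) \<longlonglongrightarrow> suminf (\<lambda>i. b (int_decode i))"
    using tannerys_theorem[of "\<lambda>i N. a N (int_decode i)" "\<lambda>i. b (int_decode i)" sequentially "\<lambda>i. M (int_decode i)"]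
      M dom lim by (simp add: case_prod_unfold)
  ultimately have s: "summable (\<lambda>i. norm (b (int_decode i)))" and "S \<longlonglongrightarrow> suminf (\<lambda>i. b (int_decode i))"
    by simp_all
  then have "suminf (\<lambda>i. b (int_decode i)) = L" using lim(2) LIMSEQ_unique by blast
  then have "((\<lambda>i. b (int_decode i)) has_sum L) UNIV"
    using norm_summable_imp_has_sum[OF s] summable_norm_cancel[OF s] summable_sums by blast
  then show ?thesis unfolding has_sum_reindex_bij_betw[OF bij] .
qed

text \<open>The quotient of consecutive terms is \<open>w * r ^ n\<close>, which tends to 0.\<close>
lemma theta_half_summable:
  fixes w r :: real
  assumes "0 < r" "r < 1" "w > 0"
  shows "(\<lambda>n. w ^ n * r powi tri (int n)) summable_on UNIV"
proof -
  have "(\<lambda>n. w * r ^ n) \<longlonglongrightarrow> w * 0"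
    using assms by (intro tendsto_intros LIMSEQ_power_zero) auto
  then have "\<forall>\<^sub>F n in sequentially. w * r ^ n < 1 / 2"
    by (rule order_tendstoD) auto
  then obtain n0 where n0: "\<And>n. n \<ge> n0 \<Longrightarrow> w * r ^ n < 1 / 2"
    by (auto simp: eventually_sequentially)
  have "summable (\<lambda>n. w ^ n * r powi tri (int n))"
  proof (rule summable_ratio_test[of "1 / 2" n0])
    fix n assume "n \<ge> n0"
    have "tri (int (Suc n)) = tri (int n) + int n"
      using two_tri[of "int n"] two_tri[of "int (Suc n)"] by (simp add: algebra_simps)
    then have "norm (w ^ Suc n * r powi tri (int (Suc n))) = (w * r ^ n) * norm (w ^ n * r powi tri (int n))"
      using assms by (simp add: power_int_add abs_mult del: of_nat_Suc)
    also have "\<dots> \<le> 1 / 2 * norm (w ^ n * r powi tri (int n))"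
      using n0[OF \<open>n \<ge> n0\<close>] by (intro mult_right_mono) auto
    finally show "norm (w ^ Suc n * r powi tri (int (Suc n))) \<le> 1 / 2 * norm (w ^ n * r powi tri (int n))" .
  qed simp
  then show ?thesis
    using assms by (subst summable_on_UNIV_nonneg_real_iff) auto
qed

text \<open>
  The terms with \<open>m = - n\<close> are those of the half series for \<open>r / w\<close>, because \<open>tri (- n) = tri n + n\<close>.
\<close>
lemma theta_summable:
  fixes w r :: real
  assumes r: "0 < r" "r < 1" and w: "w > 0"
  shows "(\<lambda>m. w powi m * r powi tri m) summable_on (UNIV :: int set)"
proof -
  have pos: "(\<lambda>m. w powi m * r powi tri m) summable_on {0..}"
    using theta_half_summable[OF r w]
    by (subst summable_on_reindex_bij_witness[of _ int nat UNIV "\<lambda>n. w ^ n * r powi tri (int n)"])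
       (auto simp: power_int_def)
  have tri_neg: "tri (- int n) = tri (int n) + int n" for n
    using two_tri[of "- int n"] two_tri[of "int n"] by (simp add: algebra_simps)
  have img: "{..0} = (\<lambda>n. - int n) ` UNIV"
  proof (intro set_eqI iffI)
    fix m :: int assume "m \<in> {..0}"
    then show "m \<in> (\<lambda>n. - int n) ` UNIV" by (intro image_eqI[of _ _ "nat (- m)"]) auto
  qed auto
  have "(\<lambda>n. w powi (- int n) * r powi tri (- int n)) summable_on UNIV"
    using theta_half_summable[OF r, of "r / w"] w r
    by (simp add: tri_neg power_int_add power_int_minus power_divide field_simps)
  then have neg: "(\<lambda>m. w powi m * r powi tri m) summable_on {..0}"
    unfolding img by (subst summable_on_reindex) (auto simp: inj_on_def o_def)
  have "(\<lambda>m. w powi m * r powi tri m) summable_on ({0..} \<union> {..<0})"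
    by (intro summable_on_Un_disjoint pos summable_on_subset_banach[OF neg]) auto
  moreover have "{0..} \<union> {..<0} = (UNIV :: int set)" by auto
  ultimately show ?thesis by simp
qed

text \<open>
  The limit \<open>N \<longrightarrow> \<infinity>\<close> of the finite triple product. Each Gaussian binomial
  \<open>qbinom q (2 * N) (m + N)\<close> tends to \<open>1 / qpochhammer q q\<close>, and the terms are dominated by a multiple
  of the absolute values of the limit series.
\<close>
theorem jacobi_triple_product:
  assumes q: "norm q < 1" "q \<noteq> 0" and z: "z \<noteq> 0"
  shows "((\<lambda>m. (- z) powi m * q powi tri m) has_sum
    qpochhammer q q * (qpochhammer z q * qpochhammer (q / z) q)) UNIV"
proof -
  obtain K where K: "\<And>n j. norm (qbinom q n j) \<le> K" using qbinom_bounded[OF q(1)] by blast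
  define t where "t = (\<lambda>m. (- z) powi m * q powi tri m)"
  define a where "a = (\<lambda>N m. if m \<in> {- int N..int N} then qbinom q (2 * N) (nat (m + int N)) * t m else 0)"
  have "((\<lambda>m. 1 / qpochhammer q q * t m) has_sum (qpochhammer z q * qpochhammer (q / z) q)) UNIV"
  proof (rule dominated_convergence_has_sum_int)
    show "(a N has_sum (\<Prod>k<N. 1 - z * q ^ k) * (\<Prod>k<N. 1 - q / z * q ^ k)) UNIV" for N
      unfolding finite_triple_product[OF q z]
      by (rule has_sum_finite_neutralI[of "{- int N..int N}"]) (auto simp: a_def t_def)
    show "(\<lambda>N. (\<Prod>k<N. 1 - z * q ^ k) * (\<Prod>k<N. 1 - q / z * q ^ k))
        \<longlonglongrightarrow> qpochhammer z q * qpochhammer (q / z) q"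
      by (intro tendsto_mult qpochhammer_LIMSEQ q)
    show "(\<lambda>N. a N m) \<longlonglongrightarrow> 1 / qpochhammer q q * t m" for m
    proof (rule Lim_transform_eventually)
      show "(\<lambda>N. qbinom q (2 * N) (nat (m + int N)) * t m) \<longlonglongrightarrow> 1 / qpochhammer q q * t m"
        by (intro tendsto_mult qbinom_LIMSEQ q tendsto_const)
      show "\<forall>\<^sub>F N in sequentially. qbinom q (2 * N) (nat (m + int N)) * t m = a N m"
        using eventually_ge_at_top[of "nat \<bar>m\<bar>"] by eventually_elim (auto simp: a_def)
    qed
    have "0 \<le> K" using K[of 0 0] norm_ge_zero order_trans by blast
    then show "norm (a N m) \<le> K * norm (t m)" for N m
      using K by (auto simp: a_def norm_mult intro!: mult_right_mono)
    have "(\<lambda>m. norm z powi m * norm q powi tri m) summable_on (UNIV :: int set)"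
      using q z by (intro theta_summable) auto
    then show "(\<lambda>m. K * norm (t m)) summable_on UNIV"
      by (intro summable_on_cmult_right) (simp add: t_def norm_mult norm_power_int)
  qed
  from has_sum_cmult_right[OF this, of "qpochhammer q q"] show ?thesis
    using qpochhammer_self_nonzero[OF q(1)] by (simp add: t_def mult.assoc)
qed

lemma has_sum_product_complex:
  fixes f :: "'a \<Rightarrow> complex" and g :: "'b \<Rightarrow> complex"
  assumes f: "(f has_sum a) A" and g: "(g has_sum b) B"
  shows "((\<lambda>(x, y). f x * g y) has_sum a * b) (A \<times> B)"
proof (rule has_sum_SigmaI)
  show "((\<lambda>y. case (x, y) of (x, y) \<Rightarrow> f x * g y) has_sum f x * b) B" for x
    using has_sum_cmult_right[OF g] by simp
  show "((\<lambda>x. f x * b) has_sum a * b) A" by (rule has_sum_cmult_left[OF f])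
  have F: "(\<lambda>x. norm (f x)) summable_on A" and G: "(\<lambda>y. norm (g y)) summable_on B"
    using f g has_sum_imp_summable summable_on_iff_abs_summable_on_complex by blast+
  have "Infinite_Sum.abs_summable_on (\<lambda>(x, y). f x * g y) (A \<times> B)"
    unfolding Infinite_Sum.abs_summable_on_Sigma_iff using F G
    by (auto simp: norm_mult infsum_cmult_right' infsum_nonneg
      intro!: summable_on_cmult_right summable_on_cmult_left)
  then show "(\<lambda>(x, y). f x * g y) summable_on A \<times> B" by (rule abs_summable_summable)
qed

section \<open>Extracting a residue class of exponents\<close>

lemma root_of_unity_filter:
  assumes "M > 0"
  obtains \<omega> :: complex where "norm \<omega> = 1" "\<omega> ^ M = 1"
    "\<And>k. (\<Sum>j<M. (\<omega> powi k) ^ j) = (if int M dvd k then of_nat M else 0)"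
proof -
  define \<omega> where "\<omega> = cis (2 * pi / real M)"
  have pw: "\<omega> powi k = cis (2 * pi * (of_int k / real M))" for k
    by (simp add: \<omega>_def cis_power_int mult_ac)
  have wM: "\<omega> ^ M = 1"
    using pw[of "int M"] assms by simp
  have "(\<Sum>j<M. (\<omega> powi k) ^ j) = (if int M dvd k then of_nat M else 0)" for k
  proof (cases "int M dvd k")
    case True
    then obtain l where "k = int M * l" by auto
    then have "\<omega> powi k = 1" by (simp add: power_int_mult wM)
    then show ?thesis using True by simp
  next
    case False
    have "\<omega> powi k \<noteq> 1"
    proof
      assume "\<omega> powi k = 1"
      then have "cis (2 * pi * (of_int k / real M)) = 1" by (simp only: pw)
      then have "cos (2 * pi * (of_int k / real M)) = 1" by (metis cis.sel(1) one_complex.sel(1))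
      then obtain l :: int where "2 * pi * (of_int k / real M) = of_int l * 2 * pi"
        using cos_one_2pi_int by blast
      then have "of_int k = real M * of_int l" using assms by (simp add: field_simps)
      then have "of_int k = (of_int (int M * l) :: real)" by simp
      then have "k = int M * l" by (simp only: of_int_eq_iff)
      then show False using False by simp
    qed
    moreover have "(\<omega> powi k) ^ M = 1"
      by (metis power_int_mult power_int_of_nat mult.commute power_int_1_left wM)
    ultimately show ?thesis using False by (simp add: geometric_sum)
  qed
  moreover have "norm \<omega> = 1" by (simp add: \<omega>_def)
  ultimately show ?thesis using that wM by blast
qed

text \<open>
  The triple product is a statement about \<open>q \<noteq> 0\<close>, so a filtered series is only known to vanish away
  from 0. Multiplying by \<open>q\<close> supplies the missing value.
\<close>
lemma powser_eq_0:
  fixes b :: "nat \<Rightarrow> complex"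
  assumes "\<And>q. norm q < 1 \<Longrightarrow> q \<noteq> 0 \<Longrightarrow> (\<lambda>n. b n * q ^ n) sums 0"
  shows "b n = 0"
proof (rule ccontr)
  define a where "a = case_nat 0 b"
  assume "b n \<noteq> 0"
  then have an: "a (Suc n) \<noteq> 0" by (simp add: a_def)
  have pw: "(\<lambda>n. a n * (q - 0) ^ n) sums (\<lambda>_. 0) q" if "norm (q - 0) < 1" for q
  proof (cases "q = 0")
    case True
    have "(\<lambda>n. a n * (q - 0) ^ n) = (\<lambda>_. 0)"
      using True by (auto simp: a_def fun_eq_iff split: nat.splits)
    then show ?thesis by simp
  next
    case False
    then have "(\<lambda>n. q * (b n * q ^ n)) sums (q * 0)"
      using that by (intro sums_mult assms) auto
    then have "(\<lambda>n. a (Suc n) * q ^ Suc n) sums 0"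
      by (simp add: a_def algebra_simps)
    then show ?thesis
      by (subst (asm) sums_Suc_iff) (simp add: a_def)
  qed
  show False
  proof (rule powser_0_nonzero[of 1 0 a "\<lambda>_. 0", OF zero_less_one pw refl an zero_less_Suc])
    fix d :: real
    assume "0 < d" and nz: "\<And>w. w \<in> cball 0 d - {0 :: complex} \<Longrightarrow> (0 :: complex) \<noteq> 0"
    then show False using nz[of "of_real d"] by simp
  qed
qed

lemma has_sum_sum_finite:
  fixes g :: "'j \<Rightarrow> 'i \<Rightarrow> complex"
  assumes "finite J" "\<And>j. j \<in> J \<Longrightarrow> (g j has_sum S j) A"
  shows "((\<lambda>i. \<Sum>j\<in>J. g j i) has_sum (\<Sum>j\<in>J. S j)) A"
  using assms by (induction J rule: finite_induct) (auto intro!: has_sum_add)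

text \<open>
  Replacing \<open>q\<close> by \<open>\<omega> ^ j * q\<close> for an \<open>M\<close>-th root of unity \<open>\<omega>\<close> leaves the factor \<open>D (q ^ M)\<close> unchanged, so
  averaging over \<open>j\<close> selects the residue class \<open>r\<close> of exponents both in the power series and in the
  signed sum over \<open>'i\<close> (a lattice, in the applications). The terms selected in the signed sum cancel
  in pairs under the involution \<open>\<phi>\<close>, hence the selected coefficients are 0.
\<close>
lemma residue_class_coefficients_vanish:
  fixes f :: "nat \<Rightarrow> complex" and e :: "'i \<Rightarrow> int" and s :: "'i \<Rightarrow> complex"
  assumes M: "r < M"
    and F: "\<And>q. norm q < 1 \<Longrightarrow> (\<lambda>n. f n * q ^ n) sums F q"
    and theta: "\<And>q. norm q < 1 \<Longrightarrow> q \<noteq> 0 \<Longrightarrow>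
      ((\<lambda>i. s i * q powi e i) has_sum D (q ^ M) * F q) UNIV"
    and D: "\<And>y. norm y < 1 \<Longrightarrow> D y \<noteq> 0"
    and inv: "\<And>i. e i mod int M = int r \<Longrightarrow> \<phi> (\<phi> i) = i \<and> e (\<phi> i) = e i \<and> s (\<phi> i) = - s i"
  shows "f (M * n + r) = 0"
proof -
  obtain \<omega> :: complex where \<omega>: "norm \<omega> = 1" "\<omega> ^ M = 1"
    and filt: "\<And>k. (\<Sum>j<M. (\<omega> powi k) ^ j) = (if int M dvd k then of_nat M else 0)"
    using root_of_unity_filter[of M] M by auto
  define u where "u k = (\<Sum>j<M. (\<omega> powi k) ^ j)" for k
  have w0: "\<omega> \<noteq> 0" using \<omega>(1) by auto
  define c where "c j = (\<omega> powi (- int r)) ^ j" for j :: nat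
  have cw: "(\<Sum>j<M. c j * (\<omega> ^ j) powi k) = u (k - int r)" for k
  proof -
    have "c j * (\<omega> ^ j) powi k = (\<omega> powi (k - int r)) ^ j" for j
    proof -
      have "(\<omega> ^ j) powi k = (\<omega> powi k) ^ j"
        by (metis power_int_mult power_int_of_nat mult.commute)
      then show ?thesis
        using w0 by (simp add: c_def power_int_diff power_int_minus field_simps)
    qed
    then show ?thesis by (simp add: u_def)
  qed
  have "(\<lambda>n. f n * u (int n - int r) * q ^ n) sums 0" if q: "norm q < 1" "q \<noteq> 0" for q
  proof -
    have q': "norm (\<omega> ^ j * q) < 1" "\<omega> ^ j * q \<noteq> 0" "(\<omega> ^ j * q) ^ M = q ^ M" for j
    proof -
      have "(\<omega> ^ j) ^ M = (\<omega> ^ M) ^ j" by (metis power_mult mult.commute)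
      then show "(\<omega> ^ j * q) ^ M = q ^ M" by (simp add: power_mult_distrib \<omega>(2))
    qed (use q \<omega>(1) w0 in \<open>auto simp: norm_mult norm_power\<close>)
    define X where "X = (\<Sum>j<M. c j * F (\<omega> ^ j * q))"
    define h where "h i = s i * q powi e i * u (e i - int r)" for i
    have "((\<lambda>i. \<Sum>j<M. c j * (s i * (\<omega> ^ j * q) powi e i)) has_sum
        (\<Sum>j<M. c j * (D (q ^ M) * F (\<omega> ^ j * q)))) UNIV"
      using theta[OF q'(1,2)] unfolding q'(3)
      by (intro has_sum_sum_finite has_sum_cmult_right) auto
    also have "(\<lambda>i. \<Sum>j<M. c j * (s i * (\<omega> ^ j * q) powi e i)) = h"
      unfolding h_def cw[symmetric]
      by (simp add: fun_eq_iff power_int_mult_distrib sum_distrib_left mult_ac)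
    also have "(\<Sum>j<M. c j * (D (q ^ M) * F (\<omega> ^ j * q))) = D (q ^ M) * X"
      by (simp only: X_def sum_distrib_left mult.left_commute)
    finally have h: "(h has_sum D (q ^ M) * X) UNIV" .
    \<comment> \<open>The given involution is only known on the residue class \<open>r\<close>; elsewhere \<open>h\<close> is 0.\<close>
    define \<psi> where "\<psi> i = (if e i mod int M = int r then \<phi> i else i)" for i
    have uz: "u (e i - int r) = 0" if "e i mod int M \<noteq> int r" for i
    proof -
      have "\<not> int M dvd e i - int r"
        using that M by (metis mod_eq_dvd_iff mod_pos_pos_trivial of_nat_0_le_iff of_nat_less_iff)
      then show ?thesis by (simp add: u_def filt)
    qed
    have "((\<lambda>i. - h i) has_sum D (q ^ M) * X) UNIV = (h has_sum D (q ^ M) * X) UNIV"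
      by (rule has_sum_reindex_bij_witness[of _ \<psi> \<psi>]) (use inv in \<open>auto simp: \<psi>_def h_def uz\<close>)
    with h have "(h has_sum - (D (q ^ M) * X)) UNIV" by (simp add: has_sum_uminus)
    with h have "D (q ^ M) * X = - (D (q ^ M) * X)" by (rule has_sum_unique)
    then have "D (q ^ M) * X = 0" by auto
    moreover have "norm (q ^ M) < 1" 
      using q(1) M by (simp add: norm_power power_less_one_iff)
    ultimately have X: "X = 0" using D by simp
    have "(\<lambda>n. \<Sum>j<M. c j * (f n * (\<omega> ^ j * q) ^ n)) sums X"
      unfolding X_def by (intro sums_sum sums_mult F q')
    also have "(\<lambda>n. \<Sum>j<M. c j * (f n * (\<omega> ^ j * q) ^ n)) = (\<lambda>n. f n * u (int n - int r) * q ^ n)"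
      unfolding cw[symmetric]
      by (simp add: fun_eq_iff power_mult_distrib sum_distrib_left sum_distrib_right mult_ac)
    finally show ?thesis unfolding X .
  qed
  from powser_eq_0[OF this, of "M * n + r"] show ?thesis
    using M by (simp add: u_def filt)
qed

section \<open>Reflections of the exponent forms\<close>

text \<open>
  The triple product in base \<open>q ^ M\<close> at \<open>z = \<delta> * q ^ a\<close> with \<open>\<delta> = 1\<close> or \<open>\<delta> = - 1\<close>; as \<open>1 / \<delta> = \<delta>\<close>, both
  Pochhammer symbols carry the same sign.
\<close>
lemma theta_has_sum:
  assumes q: "norm q < 1" "q \<noteq> 0" and M: "a \<le> M" "M > 0" and \<delta>: "\<delta> * \<delta> = (1::complex)"
  shows "((\<lambda>m. (- \<delta>) powi m * q powi (int M * tri m + int a * m)) has_sum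
    qpochhammer (q ^ M) (q ^ M) * (qpochhammer (\<delta> * q ^ a) (q ^ M) * qpochhammer (\<delta> * q ^ (M - a)) (q ^ M))) UNIV"
proof -
  have nz: "\<delta> \<noteq> 0" using \<delta> by auto
  have "norm (q ^ M) < 1" using q M by (simp add: norm_power power_less_one_iff)
  then have "((\<lambda>m. (- (\<delta> * q ^ a)) powi m * (q ^ M) powi tri m) has_sum
    qpochhammer (q ^ M) (q ^ M) * (qpochhammer (\<delta> * q ^ a) (q ^ M) * qpochhammer (q ^ M / (\<delta> * q ^ a)) (q ^ M))) UNIV"
    by (rule jacobi_triple_product) (use q nz in auto)
  also have "q ^ M / (\<delta> * q ^ a) = \<delta> * q ^ (M - a)"
    using q nz M \<delta> by (simp add: power_diff field_simps)
  also have "(\<lambda>m. (- (\<delta> * q ^ a)) powi m * (q ^ M) powi tri m) =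
      (\<lambda>m. (- \<delta>) powi m * q powi (int M * tri m + int a * m))"
  proof
    fix m
    have "(- (\<delta> * q ^ a)) powi m = (- \<delta>) powi m * q powi (int a * m)"
      by (metis mult_minus_left power_int_mult power_int_mult_distrib power_int_of_nat)
    moreover have "(q ^ M) powi tri m = q powi (int M * tri m)"
      by (metis power_int_mult power_int_of_nat)
    ultimately show "(- (\<delta> * q ^ a)) powi m * (q ^ M) powi tri m =
        (- \<delta>) powi m * q powi (int M * tri m + int a * m)"
      using q by (simp add: power_int_add)
  qed
  finally show ?thesis .
qed

lemma minus_one_power_int_add_odd:
  "odd g \<Longrightarrow> (-1 :: complex) powi (m + g) = - ((-1) powi m)"
  by (simp add: power_int_add)

text \<open>
  Here \<open>e (m, n) = 7 * tri m + a * m + 21 * tri n + b * n\<close> has quadratic part \<open>7/2 * (m\<^sup>2 + 3 * n\<^sup>2)\<close>. The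
  reflection of the plane in the direction \<open>(3, 2)\<close> that preserves \<open>e\<close> is
  \<open>(m, n) \<mapsto> (m - 3 * g, n - 2 * g)\<close> with
  \<open>147 * g = 42 * m + 84 * n - 63 + 6 * a + 4 * b\<close>, that is \<open>7 * g = 2 * m + 4 * n + c\<close>. The
  denominator 7 comes from the norm \<open>3\<^sup>2 + 3 * 2\<^sup>2 = 21\<close> of the direction. Integrality of \<open>g\<close> holds on
  the residue class \<open>r\<close> because \<open>2 * m + 4 * n + c\<close> is \<open>u * (e (m, n) - r)\<close>
  modulo 7. Since \<open>c\<close> is odd, \<open>g\<close> is odd, and the reflection changes the sign \<open>(- 1) powi m\<close>.
\<close>
lemma two_theta_coefficients_vanish:
  fixes f :: "nat \<Rightarrow> complex" and c u :: int
  assumes ab: "a \<le> 7" "b \<le> 21" "6 * int a + 4 * int b = 63 + 21 * c" "odd c"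
    and r: "r < 7" "7 dvd u * int a - 2" "7 dvd u * int b - 4" "7 dvd u * int r + c"
    and f: "\<And>q. norm q < 1 \<Longrightarrow> (\<lambda>n. f n * q ^ n) sums
      (qpochhammers [q ^ a, q ^ (7 - a)] (q ^ 7) * qpochhammers [- (q ^ b), - (q ^ (21 - b))] (q ^ 21))"
  shows "f (7 * n + r) = 0"
proof -
  define D where "D y = qpochhammer y y * qpochhammer (y ^ 3) (y ^ 3)" for y
  define e where "e = (\<lambda>(m, n). 7 * tri m + int a * m + (21 * tri n + int b * n))"
  define g where "g = (\<lambda>(m, n). (2 * m + 4 * n + c) div 7)"
  show ?thesis
  proof (rule residue_class_coefficients_vanish[where D = D and e = e and M = 7 and
        s = "\<lambda>(m, n). (- 1) powi m" and \<phi> = "\<lambda>(m, n). (m - 3 * g (m, n), n - 2 * g (m, n))", OF r(1) f])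
    fix q :: complex assume q: "norm q < 1" "q \<noteq> 0"
    have prod: "D (q ^ 7) * (qpochhammers [q ^ a, q ^ (7 - a)] (q ^ 7) *
          qpochhammers [- (q ^ b), - (q ^ (21 - b))] (q ^ 21)) =
        (qpochhammer (q ^ 7) (q ^ 7) * (qpochhammer (1 * q ^ a) (q ^ 7) * qpochhammer (1 * q ^ (7 - a)) (q ^ 7))) *
        (qpochhammer (q ^ 21) (q ^ 21) *
          (qpochhammer ((- 1) * q ^ b) (q ^ 21) * qpochhammer ((- 1) * q ^ (21 - b)) (q ^ 21)))"
      by (simp add: D_def qpochhammers_def power_mult[symmetric])
    have terms: "(\<lambda>i. (case i of (m, n) \<Rightarrow> (- 1) powi m) * q powi e i) =
        (\<lambda>(m, n). (- 1) powi m * q powi (int 7 * tri m + int a * m) *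
          ((- (- 1)) powi n * q powi (int 21 * tri n + int b * n)))"
      using q(2) by (simp add: e_def fun_eq_iff power_int_add)
    show "((\<lambda>i. (case i of (m, n) \<Rightarrow> (- 1) powi m) * q powi e i) has_sum
       D (q ^ 7) * (qpochhammers [q ^ a, q ^ (7 - a)] (q ^ 7) * qpochhammers [- (q ^ b), - (q ^ (21 - b))] (q ^ 21))) UNIV"
      unfolding prod terms UNIV_Times_UNIV[symmetric]
      by (intro has_sum_product_complex theta_has_sum q) (use ab in auto)
  next
    fix y :: complex assume "norm y < 1"
    then show "D y \<noteq> 0"
      unfolding D_def using qpochhammer_self_nonzero[of y] qpochhammer_self_nonzero[of "y ^ 3"]
      by (simp add: norm_power power_less_one_iff)
  next
    fix i assume i: "e i mod int 7 = int r"
    obtain m n where [simp]: "i = (m, n)" by (cases i)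
    have "7 dvd e i - int r" using i by (metis mod_eq_dvd_iff mod_mod_trivial of_nat_numeral)
    moreover have "2 * m + 4 * n + c = u * (e i - int r) - 7 * (u * (tri m + 3 * tri n)) -
        (u * int a - 2) * m - (u * int b - 4) * n + (u * int r + c)"
      by (simp add: e_def algebra_simps)
    ultimately have "7 dvd 2 * m + 4 * n + c"
      using r(2-4) by (metis dvd_add dvd_diff dvd_mult dvd_mult2 dvd_triv_left)
    then obtain h where h: "2 * m + 4 * n + c = 7 * h" by auto
    then have g: "g (m, n) = h" by (simp add: g_def)
    have "odd h" using h ab(4) by presburger
    have "2 * (m - 3 * h) + 4 * (n - 2 * h) + c = 7 * (- h)" using h by simp
    then have g': "g (m - 3 * h, n - 2 * h) = - h" by (simp add: g_def)
    have "2 * e (m - 3 * h, n - 2 * h) - 2 * e (m, n) =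
        h * (147 * h - 42 * m - 84 * n + 63 - (6 * int a + 4 * int b))"
      using two_tri[of "m - 3 * h"] two_tri[of "n - 2 * h"] two_tri[of m] two_tri[of n]
      by (simp add: e_def algebra_simps)
    also have "\<dots> = 0" using ab(3) h by simp
    finally have "e (m - 3 * h, n - 2 * h) = e (m, n)" by simp
    moreover have "(- 1 :: complex) powi (m - 3 * h) = - ((- 1) powi m)"
      using minus_one_power_int_add_odd[of "- 3 * h" m] \<open>odd h\<close> by simp
    ultimately show "(case case i of (m, n) \<Rightarrow> (m - 3 * g (m, n), n - 2 * g (m, n)) of
        (m, n) \<Rightarrow> (m - 3 * g (m, n), n - 2 * g (m, n))) = i \<and>
        e (case i of (m, n) \<Rightarrow> (m - 3 * g (m, n), n - 2 * g (m, n))) = e i \<and>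
        (case case i of (m, n) \<Rightarrow> (m - 3 * g (m, n), n - 2 * g (m, n)) of
          (m, n) \<Rightarrow> (- 1 :: complex) powi m) = - (case i of (m, n) \<Rightarrow> (- 1) powi m)"
      by (simp add: g g')
  qed
qed

text \<open>
  The square contributes two theta series with the same \<open>a\<close>, so the exponent
  \<open>7 * (tri m + tri n) + a * (m + n) + 21 * tri k + 6 * a * k\<close> is a function on a three-dimensional lattice.
  The reflection preserving it in the direction \<open>(3, 3, - 1)\<close> is
  \<open>(m, n, k) \<mapsto> (m - 3 * g, n - 3 * g, k + g)\<close> with \<open>7 * g = 2 * (m + n) - 2 * k - 1\<close>; the value \<open>6 * a\<close> in
  the third theta series makes the linear parts in \<open>a\<close> cancel. Again \<open>g\<close> is odd, and the reflection changes the
  sign of \<open>(- 1) powi k\<close>. The signs \<open>(- \<epsilon>) powi m\<close> and \<open>(- \<epsilon>) powi n\<close> both acquire the factor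
  \<open>(- \<epsilon>) powi (3 * g)\<close>, whose square is 1, so their product is unchanged.
\<close>
lemma three_theta_coefficients_vanish:
  fixes f :: "nat \<Rightarrow> complex" and u :: int
  assumes \<epsilon>: "\<epsilon> * \<epsilon> = 1" and a: "6 * a \<le> 21"
    and r: "r < 7" "7 dvd u * int a - 2" "7 dvd u * int r - 1"
    and f: "\<And>q. norm q < 1 \<Longrightarrow> (\<lambda>n. f n * q ^ n) sums
      ((qpochhammers [\<epsilon> * q ^ a, \<epsilon> * q ^ (7 - a)] (q ^ 7))\<^sup>2 *
        qpochhammers [q ^ (6 * a), q ^ (21 - 6 * a)] (q ^ 21))"
  shows "f (7 * n + r) = 0"
proof -
  define D where "D y = (qpochhammer y y)\<^sup>2 * qpochhammer (y ^ 3) (y ^ 3)" for y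
  define e where "e = (\<lambda>(m, n, k). 7 * tri m + int a * m + (7 * tri n + int a * n + (21 * tri k + int (6 * a) * k)))"
  define s where "s = (\<lambda>(m :: int, n :: int, k :: int). (- \<epsilon>) powi m * ((- \<epsilon>) powi n * (- 1) powi k))"
  define g where "g = (\<lambda>(m, n, k). (2 * (m + n) - 2 * k - 1) div (7 :: int))"
  define \<phi> where "\<phi> = (\<lambda>(m, n, k). (m - 3 * g (m, n, k), n - 3 * g (m, n, k), k + g (m, n, k)))"
  have nz: "\<epsilon> \<noteq> 0" using \<epsilon> by auto
  show ?thesis
  proof (rule residue_class_coefficients_vanish[where D = D and e = e and M = 7 and s = s and \<phi> = \<phi>, OF r(1) f])
    fix q :: complex assume q: "norm q < 1" "q \<noteq> 0"
    have a7: "a \<le> 7" using a by simp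
    let ?T = "qpochhammer (q ^ 7) (q ^ 7) *
      (qpochhammer (\<epsilon> * q ^ a) (q ^ 7) * qpochhammer (\<epsilon> * q ^ (7 - a)) (q ^ 7))"
    have prod: "D (q ^ 7) * ((qpochhammers [\<epsilon> * q ^ a, \<epsilon> * q ^ (7 - a)] (q ^ 7))\<^sup>2 *
          qpochhammers [q ^ (6 * a), q ^ (21 - 6 * a)] (q ^ 21)) =
        ?T * (?T * (qpochhammer (q ^ 21) (q ^ 21) *
          (qpochhammer (1 * q ^ (6 * a)) (q ^ 21) * qpochhammer (1 * q ^ (21 - 6 * a)) (q ^ 21))))"
      by (simp add: D_def qpochhammers_def power2_eq_square power_mult[of q 7 3, simplified])
    have terms: "(\<lambda>i. s i * q powi e i) =
        (\<lambda>(m, i). (- \<epsilon>) powi m * q powi (int 7 * tri m + int a * m) *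
          (case i of (n, k) \<Rightarrow> (- \<epsilon>) powi n * q powi (int 7 * tri n + int a * n) *
            ((- 1) powi k * q powi (int 21 * tri k + int (6 * a) * k))))"
      using q(2) by (simp add: s_def e_def fun_eq_iff power_int_add)
    show "((\<lambda>i. s i * q powi e i) has_sum D (q ^ 7) *
        ((qpochhammers [\<epsilon> * q ^ a, \<epsilon> * q ^ (7 - a)] (q ^ 7))\<^sup>2 *
          qpochhammers [q ^ (6 * a), q ^ (21 - 6 * a)] (q ^ 21))) UNIV"
      unfolding prod terms UNIV_Times_UNIV[symmetric]
      by (intro has_sum_product_complex theta_has_sum q) (use a a7 \<epsilon> in auto)
  next
    fix y :: complex assume "norm y < 1"
    then show "D y \<noteq> 0"
      unfolding D_def using qpochhammer_self_nonzero[of y] qpochhammer_self_nonzero[of "y ^ 3"]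
      by (simp add: norm_power power_less_one_iff)
  next
    fix i assume i: "e i mod int 7 = int r"
    obtain m n k where [simp]: "i = (m, n, k)" by (cases i)
    have "7 dvd e i - int r" using i by (metis mod_eq_dvd_iff mod_mod_trivial of_nat_numeral)
    moreover have "2 * (m + n) - 2 * k - 1 = u * (e i - int r) -
        7 * (u * (tri m + tri n + 3 * tri k) + 2 * k) -
        (u * int a - 2) * (m + n + 6 * k) + (u * int r - 1)"
      by (simp add: e_def algebra_simps)
    ultimately have "7 dvd 2 * (m + n) - 2 * k - 1"
      using r(2-3) by (metis dvd_add dvd_diff dvd_mult dvd_mult2 dvd_triv_left)
    then obtain h where h: "2 * (m + n) - 2 * k - 1 = 7 * h" by auto
    then have g: "g (m, n, k) = h" by (simp add: g_def)
    have "odd h" using h by presburger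
    have "2 * ((m - 3 * h) + (n - 3 * h)) - 2 * (k + h) - 1 = 7 * (- h)" using h by simp
    then have g': "g (m - 3 * h, n - 3 * h, k + h) = - h" by (simp only: g_def prod.case)
    have \<phi>: "\<phi> (m, n, k) = (m - 3 * h, n - 3 * h, k + h)" by (simp add: \<phi>_def g)
    have "2 * e (m - 3 * h, n - 3 * h, k + h) - 2 * e (m, n, k) =
        h * (147 * h - 21 * (2 * (m + n) - 2 * k - 1))"
      using two_tri[of "m - 3 * h"] two_tri[of "n - 3 * h"] two_tri[of "k + h"]
        two_tri[of m] two_tri[of n] two_tri[of k]
      by (simp add: e_def algebra_simps)
    also have "\<dots> = 0" using h by simp
    finally have "e (m - 3 * h, n - 3 * h, k + h) = e (m, n, k)" by simp
    moreover have "s (m - 3 * h, n - 3 * h, k + h) = - s (m, n, k)"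
    proof -
      have "(- \<epsilon>) powi (3 * h) * (- \<epsilon>) powi (3 * h) = 1"
        using \<epsilon> by (simp flip: power_int_mult_distrib)
      then show ?thesis
        using nz \<open>odd h\<close> by (simp add: s_def minus_one_power_int_add_odd power_int_diff)
    qed
    moreover have "\<phi> (\<phi> (m, n, k)) = (m, n, k)"
      unfolding \<phi> by (simp add: \<phi>_def g')
    ultimately show "\<phi> (\<phi> i) = i \<and> e (\<phi> i) = e i \<and> s (\<phi> i) = - s i"
      by (simp add: \<phi>)
  qed
qed

theorem theorem3p6:
  fixes k l t o' p z :: "nat \<Rightarrow> complex" and \<epsilon> :: complex
  assumes eps: "\<epsilon> \<in> {1, -1}"
  assumes k: "\<And>q. norm q < 1 \<Longrightarrow> (\<lambda>n. k n * q ^ n) sums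
    (qpochhammers [q, q^6] (q^7) * qpochhammers [- (q^9), - (q^12)] (q^21))"
  assumes l: "\<And>q. norm q < 1 \<Longrightarrow> (\<lambda>n. l n * q ^ n) sums
    (qpochhammers [q^2, q^5] (q^7) * qpochhammers [- (q^3), - (q^18)] (q^21))"
  assumes t: "\<And>q. norm q < 1 \<Longrightarrow> (\<lambda>n. t n * q ^ n) sums
    (qpochhammers [q^3, q^4] (q^7) * qpochhammers [- (q^6), - (q^15)] (q^21))"
  assumes oo: "\<And>q. norm q < 1 \<Longrightarrow> (\<lambda>n. o' n * q ^ n) sums
    ((qpochhammers [\<epsilon> * q, \<epsilon> * q^6] (q^7))^2 * qpochhammers [q^6, q^15] (q^21))"
  assumes p: "\<And>q. norm q < 1 \<Longrightarrow> (\<lambda>n. p n * q ^ n) sums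
    ((qpochhammers [\<epsilon> * q^2, \<epsilon> * q^5] (q^7))^2 * qpochhammers [q^9, q^12] (q^21))"
  assumes z: "\<And>q. norm q < 1 \<Longrightarrow> (\<lambda>n. z n * q ^ n) sums
    ((qpochhammers [\<epsilon> * q^3, \<epsilon> * q^4] (q^7))^2 * qpochhammers [q^3, q^18] (q^21))"
  shows "\<forall>n. k (7*n+4) = 0 \<and> l (7*n+6) = 0 \<and> t (7*n+5) = 0 \<and>
             o' (7*n+4) = 0 \<and> p (7*n+1) = 0 \<and> z (7*n+5) = 0"
proof (intro allI conjI)
  have \<epsilon>: "\<epsilon> * \<epsilon> = 1" using eps by auto
  have swap: "qpochhammers [x, y] q = qpochhammers [y, x] q" for x y q
    by (simp add: qpochhammers_def mult.commute)
  \<comment> \<open>The theta series in base \<open>q ^ 21\<close> is symmetric under \<open>b \<mapsto> 21 - b\<close>, which reverses its summation index. The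
    choices 18, 12 and 18 of \<open>b\<close> give the reflections the directions fixed above.\<close>
  note l' = l[unfolded swap[of "- (q ^ 3)" "- (q ^ 18)" for q]]
    and p' = p[unfolded swap[of "q ^ 9" "q ^ 12" for q]]
    and z' = z[unfolded swap[of "q ^ 3" "q ^ 18" for q]]
  fix n
  show "k (7 * n + 4) = 0"
    by (rule two_theta_coefficients_vanish[where a = 1 and b = 9 and c = "- 1" and u = 2])
       (use k in auto)
  show "l (7 * n + 6) = 0"
    by (rule two_theta_coefficients_vanish[where a = 2 and b = 18 and c = 1 and u = 1])
       (use l' in auto)
  show "t (7 * n + 5) = 0"
    by (rule two_theta_coefficients_vanish[where a = 3 and b = 6 and c = "- 1" and u = 3])
       (use t in auto)
  show "o' (7 * n + 4) = 0"
    by (rule three_theta_coefficients_vanish[OF \<epsilon>, where a = 1 and u = 2])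
       (use oo in auto)
  show "p (7 * n + 1) = 0"
    by (rule three_theta_coefficients_vanish[OF \<epsilon>, where a = 2 and u = 1])
       (use p' in auto)
  show "z (7 * n + 5) = 0"
    by (rule three_theta_coefficients_vanish[OF \<epsilon>, where a = 3 and u = 3])
       (use z' in auto)
qed

end
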